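(* Suppose that $q\equiv\pm1\pmod{20}$, so that $5$ is a square in $\mathbb{F}_q$. Set $c=(5+\sqrt5)/8\in\mathbb{F}_q$ for either choice of the square root $\sqrt5\in\mathbb{F}_q$. Then $c\in\mathcal{C}$, and for $s\in\mathbb{F}_q$ with $1-s^2=c$, each monic irreducible factor $I(y)$ of $g_s(y)$ over $\mathbb{F}_q$ has the form $$y^5-\frac52y^4+\frac{35}{16}y^3-\frac{25}{32}y^2+\frac{25}{256}y-m$$ for some $m\in\mathbb{F}_q$.
   Context: $\mathbb{F}_q$ is a finite field with $q$ elements, $q$ a power of an odd prime; $n=(q+1)/2$; for $s\in\mathbb{F}_q$, $g_s(y) := y^n+(1-y)^n-s \in \mathbb{F}_q[y]$. $\rho$ is the quadratic character on $\mathbb{F}_q$ and $\mathcal{C} := \{a \in \mathbb{F}_q : \rho(a)=\rho(1-a)=1\}$. *)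

theory Defs
  imports "HOL-Library.Cardinality" "HOL-Computational_Algebra.Polynomial_Factorial" "HOL-Number_Theory.Cong"
begin

text \<open>The field with q elements is a type \<open>'a :: {field, finite}\<close>, with \<open>q = CARD('a)\<close>.\<close>

definition quad_char :: "'a :: {field, finite} \<Rightarrow> int" where
  "quad_char a = (if a = 0 then 0 else if \<exists>b. a = b ^ 2 then 1 else - 1)"

definition C_set :: "'a :: {field, finite} set" where
  "C_set = {a. quad_char a = 1 \<and> quad_char (1 - a) = 1}"

text \<open>The polynomial \<open>y ^ n + (1 - y) ^ n - s\<close> with \<open>n = (q + 1) / 2\<close>; the division is exact for
  odd q. Here \<open>[:0, 1:]\<close> is y and \<open>[:1, - 1:]\<close> is \<open>1 - y\<close>.\<close>

definition g_poly :: "'a :: {field, finite} \<Rightarrow> 'a poly" where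
  "g_poly s = (let n = (CARD('a) + 1) div 2 in [:0, 1:] ^ n + [:1, - 1:] ^ n - [:s:])"

end

theory Submission
  imports Defs "HOL-Algebra.Algebraic_Closure_Type" "HOL-Number_Theory.Residues"
begin

text \<open>
  Let \<open>q\<close> be the size of the field, \<open>n = (q + 1) / 2\<close>, and \<open>y\<close> a root of \<open>g\<^sub>s\<close> in the algebraic
  closure. Everything is guided by the substitution \<open>y = cos\<^sup>2 \<theta>\<close>. Under it \<open>y\<^sup>n + (1 - y)\<^sup>n = s\<close>
  reads \<open>cos \<theta> cos \<theta>' + sin \<theta> sin \<theta>' = s\<close> with \<open>y\<^sup>q = cos\<^sup>2 \<theta>'\<close>, so that Frobenius turns the angle
  \<open>\<theta>\<close> by a fixed angle whose cosine is \<open>s\<close>, up to sign. As \<open>1 - s\<^sup>2 = (5 \<plusminus> \<surd>5) / 8\<close>, that angle is a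
  multiple of \<open>\<pi>/5\<close>. Hence \<open>cos\<^sup>2 5\<theta>\<close> is fixed by Frobenius. It is a quintic polynomial in \<open>y\<close>, and
  up to the factor 256 it is the quintic of the statement. So \<open>y\<close> is a root of that quintic for
  some \<open>m\<close> in the base field; if \<open>y\<close> has five distinct conjugates, this is its minimal polynomial.

  In place of angles and square roots of \<open>y\<close>, the argument uses a symmetric
  relation between \<open>y\<close> and \<open>Y = y\<^sup>q\<close>. The elements \<open>A = y\<^sup>n\<close> and \<open>B = (1 - y)\<^sup>n\<close> satisfy
  \<open>A\<^sup>2 = Y y\<close>, \<open>B\<^sup>2 = (1 - Y) (1 - y)\<close> and \<open>A + B = s\<close>, and eliminating them gives
  \<open>(Y + y - c)\<^sup>2 = 4 (1 - c) Y y\<close> for \<open>c = 1 - s\<^sup>2\<close> (\<open>conjugate_relation\<close>). For the two values of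
  \<open>c\<close> this biquadratic divides the difference of the quintic at \<open>Y\<close> and \<open>y\<close>
  (\<open>quintic_eq_if_biquadratic\<close>).

  The five conjugates come from the same relation. For a given middle term it is a quadratic
  equation for the two neighbours in the Frobenius orbit. If these are distinct, Vieta's formula
  gives a linear recurrence, whose characteristic roots are primitive fifth roots of unity, so
  the orbit has period exactly five (\<open>five_conjugates\<close>). That the neighbours are distinct is
  where the squareness of \<open>c\<close> enters (\<open>Frobenius_squared_moves_root\<close>): if they coincided, an explicit
  square root of \<open>4 y (1 - y)\<close> would yield \<open>4 A B = - 4 A B\<close>. The squareness itself comes from
  \<open>4 c = (\<zeta> + \<zeta>\<^sup>-\<^sup>1)\<^sup>2\<close> for a primitive twentieth root of unity \<open>\<zeta>\<close>, because Frobenius maps \<open>\<zeta>\<close> to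
  \<open>\<zeta>\<close> or \<open>\<zeta>\<^sup>-\<^sup>1\<close> when \<open>q \<equiv> \<plusminus>1 (mod 20)\<close> (\<open>golden_square_root\<close>).
\<close>

text \<open>Hypotheses are passed to the Groebner basis method as vanishing polynomials.\<close>
lemmas eq_diff_0 = eq_iff_diff_eq_0[THEN iffD1]

text \<open>The unqualified names below refer to polynomials with coefficients in a type.\<close>
hide_const (open) Divisibility.irreducible Polynomials.degree Polynomials.lead_coeff
  up_ring.coeff up_ring.monom Module.smult

section \<open>The Frobenius map on the algebraic closure of a finite field\<close>

lemma power_CARD_eq_self:
  fixes a :: "'a :: {field, finite}"
  shows "a ^ CARD('a) = a"
proof (cases "a = 0")
  case False
  define P where "P = (\<Prod>x\<in>UNIV - {0 :: 'a}. x)"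
  have "bij_betw (\<lambda>x. a * x) (UNIV - {0}) (UNIV - {0})"
    by (rule bij_betwI[where g = "\<lambda>x. x / a"]) (use False in auto)
  hence "P = (\<Prod>x\<in>UNIV - {0}. a * x)"
    unfolding P_def by (rule prod.reindex_bij_betw[symmetric])
  also have "\<dots> = a ^ (CARD('a) - 1) * P"
    by (simp add: prod.distrib P_def)
  finally have "a ^ (CARD('a) - 1) = 1"
    by (simp add: P_def)
  moreover have "a ^ CARD('a) = a * a ^ (CARD('a) - 1)"
    by (simp add: power_eq_if)
  ultimately show ?thesis by simp
qed auto

lemma Frobenius_to_ac [simp]: "to_ac (a :: 'a :: {field, finite}) ^ CARD('a) = to_ac a"
  by (metis power_CARD_eq_self to_ac_power)

lemma CARD_gt_1: "CARD('a :: {field, finite}) > 1"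
proof -
  have "card {0, 1 :: 'a} \<le> CARD('a)"
    by (intro card_mono) auto
  thus ?thesis by simp
qed

text \<open>As polynomials in \<open>x\<close>, both sides of the conclusion are monic of degree \<open>q\<close>, so they agree as
  soon as they agree at the \<open>q\<close> elements of the base field. Additivity of Frobenius follows by
  two applications, the first with \<open>y\<close> in the base field.\<close>
lemma Frobenius_additive_aux:
  fixes y :: "'a :: {field, finite} alg_closure"
  assumes "\<And>a :: 'a. (to_ac a + y) ^ CARD('a) = to_ac a + y ^ CARD('a)"
  shows "(x + y) ^ CARD('a) = x ^ CARD('a) + y ^ CARD('a)"
proof -
  define q where "q = CARD('a)"
  have q: "q > 1"
    unfolding q_def by (rule CARD_gt_1)
  define L where "L = [:y, 1:] ^ q"
  define M where "M = monom 1 q + [:y ^ q:]"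
  have deg: "degree L = q" "degree M = q"
    using q by (auto simp: L_def M_def degree_power_eq degree_monom_eq degree_add_eq_left)
  have "L = M"
  proof (rule poly_eqI_degree_lead_coeff[where n = q and A = "range to_ac"])
    show "coeff L q = coeff M q"
      using lead_coeff_power[of "[:y, 1:]" q] q deg
      by (auto simp: L_def M_def coeff_pCons split: nat.splits)
    show "q \<le> card (range (to_ac :: 'a \<Rightarrow> _))"
      by (simp add: card_image inj_to_ac q_def)
    show "poly L z = poly M z" if z: "z \<in> range to_ac" for z
    proof -
      obtain a where "z = to_ac a" using z by auto
      thus ?thesis
        using assms[of a] by (simp add: L_def M_def q_def poly_monom add.commute)
    qed
  qed (use deg in auto)
  hence "poly L x = poly M x" by simp
  thus ?thesis
    by (simp add: L_def M_def q_def poly_monom add.commute)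
qed

lemma Frobenius_add:
  fixes x y :: "'a :: {field, finite} alg_closure"
  shows "(x + y) ^ CARD('a) = x ^ CARD('a) + y ^ CARD('a)"
proof (rule Frobenius_additive_aux)
  fix a :: 'a
  have "(y + to_ac a) ^ CARD('a) = y ^ CARD('a) + to_ac a ^ CARD('a)"
  proof (rule Frobenius_additive_aux)
    fix b :: 'a
    show "(to_ac b + to_ac a) ^ CARD('a) = to_ac b + to_ac a ^ CARD('a)"
      by (metis Frobenius_to_ac to_ac_add)
  qed
  thus "(to_ac a + y) ^ CARD('a) = to_ac a + y ^ CARD('a)"
    by (simp add: add.commute)
qed

lemma Frobenius_diff:
  fixes x y :: "'a :: {field, finite} alg_closure"
  shows "(x - y) ^ CARD('a) = x ^ CARD('a) - y ^ CARD('a)"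
  using Frobenius_add[of "x - y" y] by (simp add: algebra_simps)

lemma Frobenius_eq_iff [simp]:
  fixes x y :: "'a :: {field, finite} alg_closure"
  shows "x ^ CARD('a) = y ^ CARD('a) \<longleftrightarrow> x = y"
  using Frobenius_diff[of x y] by (auto dest: sym)

text \<open>The base field already supplies \<open>q\<close> roots of the polynomial \<open>X\<^sup>q - X\<close>.\<close>
lemma Frobenius_fixed_imp_in_base:
  fixes x :: "'a :: {field, finite} alg_closure"
  assumes "x ^ CARD('a) = x"
  shows "x \<in> range to_ac"
proof (rule ccontr)
  assume x: "x \<notin> range to_ac"
  define q where "q = CARD('a)"
  have q: "q > 1"
    unfolding q_def by (rule CARD_gt_1)
  define L where "L = monom 1 q - [:0, 1 :: 'a alg_closure:]"
  have L: "coeff L q = 1"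
    using q by (auto simp: L_def coeff_pCons split: nat.splits)
  have deg: "degree L \<le> q"
    unfolding L_def using q by (intro degree_diff_le) (auto simp: degree_monom_eq)
  have "insert x (range (to_ac :: 'a \<Rightarrow> _)) \<subseteq> {z. poly L z = 0}"
    using assms by (auto simp: L_def q_def poly_monom)
  hence "card (insert x (range (to_ac :: 'a \<Rightarrow> _))) \<le> card {z. poly L z = 0}"
    using L by (intro card_mono poly_roots_finite) auto
  also have "\<dots> \<le> degree L"
    using L by (intro card_poly_roots_bound) auto
  finally show False
    using deg x by (simp add: card_image inj_to_ac q_def)
qed

section \<open>Roots of polynomials over the base field\<close>

abbreviation ac_eval :: "'a :: field poly \<Rightarrow> 'a alg_closure \<Rightarrow> 'a alg_closure" where
  "ac_eval p x \<equiv> poly (map_poly to_ac p) x"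

lemma ac_eval_add [simp]: "ac_eval (p + q) x = ac_eval p x + ac_eval q x"
proof -
  have "map_poly to_ac (p + q) = map_poly to_ac p + map_poly to_ac q"
    by (intro poly_eqI) (simp add: coeff_map_poly)
  thus ?thesis by simp
qed

lemma ac_eval_smult [simp]: "ac_eval (smult a p) x = to_ac a * ac_eval p x"
  by (simp add: map_poly_smult)

lemma ac_eval_pCons [simp]: "ac_eval (pCons a p) x = to_ac a + x * ac_eval p x"
  by (simp add: map_poly_pCons)

lemma ac_eval_mult [simp]: "ac_eval (p * q) x = ac_eval p x * ac_eval q x"
  by (induction p) (auto simp: algebra_simps)

lemma ac_eval_power [simp]: "ac_eval (p ^ k) x = ac_eval p x ^ k"
  by (induction k) auto

lemma ac_eval_diff [simp]: "ac_eval (p - q) x = ac_eval p x - ac_eval q x"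
  using ac_eval_add[of "p - q" q x] by (simp add: algebra_simps del: ac_eval_add)

lemma ac_eval_Frobenius:
  fixes x :: "'a :: {field, finite} alg_closure"
  shows "ac_eval p (x ^ CARD('a)) = ac_eval p x ^ CARD('a)"
  by (induction p) (auto simp: Frobenius_add power_mult_distrib zero_power)

lemma ac_root_exists:
  fixes p :: "'a :: field poly"
  assumes "irreducible p"
  obtains x where "ac_eval p x = 0"
proof -
  have "degree p \<noteq> 0"
    using assms is_unit_iff_degree[of p] irreducible_not_unit[of p] by (cases "p = 0") auto
  hence "degree (map_poly to_ac p) > 0"
    by (simp add: degree_map_poly)
  thus ?thesis
    using alg_closed_imp_poly_has_root that by blast
qed

text \<open>A nonzero polynomial \<open>h\<close> of least degree with root \<open>x\<close> divides all polynomials with root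
  \<open>x\<close>, by division with remainder; irreducibility makes \<open>p\<close> an associate of \<open>h\<close>.\<close>
lemma irreducible_dvd_if_common_root:
  fixes p f :: "'a :: field poly"
  assumes p: "irreducible p" and x: "ac_eval p x = 0" "ac_eval f x = 0"
  shows "p dvd f"
proof -
  define Q where "Q = (\<lambda>h :: 'a poly. h \<noteq> 0 \<and> ac_eval h x = 0)"
  have "Q p"
    using p x by (auto simp: Q_def)
  then obtain h where h: "Q h" and min: "\<And>k. Q k \<Longrightarrow> degree h \<le> degree k"
    using ex_has_least_nat[of Q p degree] by blast
  have dvd: "h dvd k" if "ac_eval k x = 0" for k
  proof -
    have "ac_eval (k div h * h + k mod h) x = 0"
      using that by simp
    hence "ac_eval (k mod h) x = 0"
      using h unfolding ac_eval_add ac_eval_mult by (simp add: Q_def)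
    hence "\<not> degree (k mod h) < degree h" if "k mod h \<noteq> 0"
      using min[of "k mod h"] that by (auto simp: Q_def)
    hence "k mod h = 0"
      using h degree_mod_less[of h k] by (auto simp: Q_def)
    thus ?thesis by auto
  qed
  from dvd[OF x(1)] obtain k where k: "p = h * k" ..
  have "\<not> h dvd 1"
  proof
    assume "h dvd 1"
    then obtain h' where "1 = h * h'" ..
    hence "ac_eval 1 x = ac_eval h x * ac_eval h' x"
      by (metis ac_eval_mult)
    thus False using h by (simp add: Q_def)
  qed
  hence "k dvd 1"
    using Factorial_Ring.irreducibleD[OF p k] by blast
  hence "p dvd h"
    unfolding k by simp
  thus ?thesis
    using dvd[OF x(2)] by (rule dvd_trans)
qed

section \<open>The golden ratio and the twentieth roots of unity\<close>

lemma CARD_mod_20_cases: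
  assumes "[int q = 1] (mod 20) \<or> [int q = - 1] (mod 20)"
  obtains k where "q = 20 * k + 1" | k where "q + 1 = 20 * k"
proof -
  from assms have "20 dvd int q - 1 \<or> 20 dvd int (q + 1)"
    by (auto simp: cong_iff_dvd_diff add.commute)
  thus ?thesis
  proof
    assume "20 dvd int q - 1"
    hence "\<exists>k. q = 20 * k + 1" by presburger
    thus ?thesis using that(1) by blast
  next
    assume "20 dvd int (q + 1)"
    hence "20 dvd q + 1" by presburger
    thus ?thesis using that(2) by blast
  qed
qed

text \<open>The number \<open>q\<close> is zero in the field, but it is \<open>\<plusminus>1\<close> modulo 20.\<close>
lemma twenty_nonzero:
  assumes "[int CARD('a :: {field, finite}) = 1] (mod 20) \<or> [int CARD('a) = - 1] (mod 20)"
  shows "(20 :: 'a) \<noteq> 0"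
proof
  assume 20: "(20 :: 'a) = 0"
  have 0: "of_nat CARD('a) = (0 :: 'a)"
    using CHAR_dvd_CARD[where ?'a = 'a] by (simp add: of_nat_eq_0_iff_char_dvd)
  from assms show False
  proof (rule CARD_mod_20_cases)
    fix k assume "CARD('a) = 20 * k + 1"
    hence "(of_nat CARD('a) :: 'a) = 20 * of_nat k + 1"
      by (simp only: of_nat_add of_nat_mult of_nat_1 of_nat_numeral)
    thus False using 20 0 by simp
  next
    fix k assume "CARD('a) + 1 = 20 * k"
    hence "(of_nat (CARD('a) + 1) :: 'a) = of_nat (20 * k)"
      by (simp only:)
    hence "(of_nat CARD('a) + 1 :: 'a) = 20 * of_nat k"
      by (simp only: of_nat_add of_nat_mult of_nat_1 of_nat_numeral)
    thus False using 20 0 by simp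
  qed
qed

lemma two_nonzero:
  assumes "[int CARD('a :: {field, finite}) = 1] (mod 20) \<or> [int CARD('a) = - 1] (mod 20)"
  shows "(2 :: 'a) \<noteq> 0"
proof
  assume "(2 :: 'a) = 0"
  hence "2 * 10 = (0 :: 'a)" by (simp only: mult_zero_left)
  thus False using twenty_nonzero[OF assms] by simp
qed

text \<open>The element \<open>t\<close> is \<open>2 cos (\<pi>/10)\<close> or \<open>2 cos (3\<pi>/10)\<close> up to sign, the trace \<open>z + z\<^sup>-\<^sup>1\<close> of a primitive
  twentieth root of unity. Frobenius fixes or inverts \<open>z\<close>, hence fixes \<open>t\<close>. Here \<open>R\<close> is taken
  in the closure, so that the lemma also shows that \<open>R = 2 t\<^sup>2 - 5\<close> lies in the base field.\<close>
lemma golden_square_root: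
  fixes R :: "'a :: {field, finite} alg_closure"
  assumes q: "[int CARD('a) = 1] (mod 20) \<or> [int CARD('a) = - 1] (mod 20)"
    and R: "R ^ 2 = 5"
  obtains t :: 'a where "to_ac t ^ 2 = (5 + R) / 2"
proof -
  have "to_ac (2 :: 'a) \<noteq> 0"
    using two_nonzero[OF q] by (simp del: to_ac_numeral)
  hence two: "(2 :: 'a alg_closure) \<noteq> 0" by simp
  obtain t where t: "t ^ 2 = (5 + R) / 2"
    using nth_root_exists[of 2 "(5 + R) / 2"] by auto
  have "2 * t ^ 2 = 5 + R"
    using t two by (simp add: field_simps)
  hence "(2 * t ^ 2 - 5) ^ 2 - 5 = 0"
    using R by simp
  hence "2 * 2 * (t ^ 4 - 5 * t ^ 2 + 5) = 0"
    by Groebner_Basis.algebra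
  hence quartic: "t ^ 4 - 5 * t ^ 2 + 5 = 0"
    using two by (metis mult_eq_0_iff)
  obtain z where "poly [:1, - t, 1:] z = 0"
    using alg_closed_imp_poly_has_root[of "[:1, - t, 1:]"] by auto
  hence z: "z * (t - z) = 1"
    by (simp add: algebra_simps)
  \<comment> \<open>With \<open>t = w + w\<^sup>-\<^sup>1\<close> the quartic becomes the twentieth cyclotomic polynomial of \<open>w\<close>.\<close>
  have unity: "w ^ 20 = 1" if w: "w * (t - w) = 1" for w
  proof -
    have "w ^ 10 = - 1"
      using w[THEN eq_diff_0] quartic[THEN eq_diff_0] by Groebner_Basis.algebra
    hence "(w ^ 10) ^ 2 = 1" by simp
    thus ?thesis by (simp flip: power_mult)
  qed
  have z20: "z ^ 20 = 1" "(t - z) ^ 20 = 1"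
    using unity[of z] unity[of "t - z"] z by (simp_all add: mult.commute)
  have "z ^ CARD('a) + (t - z) ^ CARD('a) = t"
    using q
  proof (rule CARD_mod_20_cases)
    fix k assume "CARD('a) = 20 * k + 1"
    thus ?thesis using z20 by (simp add: power_add power_mult)
  next
    fix k assume "CARD('a) + 1 = 20 * k"
    hence "w ^ CARD('a) * w = 1" if "w ^ 20 = 1" for w :: "'a alg_closure"
      using that by (metis Suc_eq_plus1 power_Suc2 power_mult power_one)
    hence "z ^ CARD('a) * z = 1" "(t - z) ^ CARD('a) * (t - z) = 1"
      using z20 by auto
    hence "z ^ CARD('a) = t - z" "(t - z) ^ CARD('a) = z"
      using z by (metis inverse_unique mult.commute)+
    thus ?thesis by simp
  qed
  hence "t ^ CARD('a) = t"
    using Frobenius_add[of z "t - z"] by simp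
  then obtain t0 where "t = to_ac t0"
    using Frobenius_fixed_imp_in_base by blast
  thus ?thesis using that t by blast
qed

lemma five_is_square:
  assumes q: "[int CARD('a :: {field, finite}) = 1] (mod 20) \<or> [int CARD('a) = - 1] (mod 20)"
  shows "\<exists>r :: 'a. r ^ 2 = 5"
proof -
  obtain R :: "'a alg_closure" where R: "R ^ 2 = 5"
    using nth_root_exists[of 2 "5 :: 'a alg_closure"] by auto
  obtain t :: 'a where t: "to_ac t ^ 2 = (5 + R) / 2"
    using golden_square_root[OF q R] .
  have "to_ac (2 :: 'a) \<noteq> 0"
    using two_nonzero[OF q] by (simp del: to_ac_numeral)
  hence "(2 :: 'a alg_closure) \<noteq> 0" by simp
  hence "2 * to_ac t ^ 2 = 5 + R"
    using t by (simp add: field_simps)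
  hence "R = to_ac (2 * t ^ 2 - 5)"
    by simp
  hence "to_ac ((2 * t ^ 2 - 5) ^ 2) = to_ac (5 :: 'a)"
    using R by simp
  thus ?thesis
    unfolding to_ac_eq_iff by blast
qed

section \<open>The relation between a root and its conjugate\<close>

text \<open>The polynomial \<open>y (16 y\<^sup>2 - 20 y + 5)\<^sup>2 / 256\<close>, which sends \<open>cos\<^sup>2 \<theta>\<close> to \<open>cos\<^sup>2 5\<theta> / 256\<close>.\<close>
definition quintic :: "'a :: field \<Rightarrow> 'a" where
  "quintic y = y ^ 5 - 5 / 2 * y ^ 4 + 35 / 16 * y ^ 3 - 25 / 32 * y ^ 2 + 25 / 256 * y"

text \<open>The difference of the quintics is \<open>Y - y\<close> times the product of the biquadratics
  \<open>(Y + y - c)\<^sup>2 - 4 (1 - c) Y y\<close> for the two roots \<open>c\<close> of the given quadratic.\<close>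
lemma quintic_eq_if_biquadratic:
  fixes y Y c :: "'a :: field"
  assumes two: "(2 :: 'a) \<noteq> 0" and c: "16 * c ^ 2 - 20 * c + 5 = 0"
    and rel: "(Y + y - c) ^ 2 = 4 * (1 - c) * Y * y"
  shows "quintic Y = quintic y"
proof -
  have nz: "(16 :: 'a) \<noteq> 0" "(32 :: 'a) \<noteq> 0" "(256 :: 'a) \<noteq> 0"
    using two power_not_zero[of "2 :: 'a" 4] power_not_zero[of "2 :: 'a" 5]
      power_not_zero[of "2 :: 'a" 8] by simp_all
  have clear: "256 * (z ^ 5 - a * z ^ 4 + b * z ^ 3 - d * z ^ 2 + e * z) =
      z * (16 * z ^ 2 - 20 * z + 5) ^ 2"
    if "2 * a = 5" "16 * b = 35" "32 * d = 25" "256 * e = 25" for a b d e z :: 'a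
    using that[THEN eq_diff_0] by Groebner_Basis.algebra
  have "256 * quintic z = z * (16 * z ^ 2 - 20 * z + 5) ^ 2" for z :: 'a
    unfolding quintic_def by (rule clear) (use two nz in simp_all)
  moreover have "Y * (16 * Y ^ 2 - 20 * Y + 5) ^ 2 = y * (16 * y ^ 2 - 20 * y + 5) ^ 2"
    using rel[THEN eq_diff_0] c[THEN eq_diff_0] by Groebner_Basis.algebra
  ultimately show ?thesis
    using nz by (metis mult_left_cancel)
qed

text \<open>Since \<open>2 n = q + 1\<close>, the square of \<open>w\<^sup>n\<close> is \<open>w\<^sup>q w\<close>. Eliminating \<open>(1 - y)\<^sup>n = s - y\<^sup>n\<close> from
  these identities for \<open>w = y\<close> and \<open>w = 1 - y\<close> leaves an equation linear in \<open>y\<^sup>n\<close>.\<close>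
lemma conjugate_relation:
  fixes y :: "'a :: {field, finite} alg_closure"
  assumes n: "2 * n = CARD('a) + 1"
    and s: "y ^ n + (1 - y) ^ n = to_ac s"
  shows "2 * to_ac s * y ^ n = y ^ CARD('a) + y - to_ac (1 - s ^ 2)"
    and "(y ^ n) ^ 2 = y ^ CARD('a) * y"
    and "(y ^ CARD('a) + y - to_ac (1 - s ^ 2)) ^ 2
      = 4 * (1 - to_ac (1 - s ^ 2)) * y ^ CARD('a) * y"
proof -
  define Y where "Y = y ^ CARD('a)"
  have sq: "(w ^ n) ^ 2 = w ^ CARD('a) * w" for w :: "'a alg_closure"
    using n by (metis Suc_eq_plus1 mult.commute power_Suc2 power_mult)
  have A: "(y ^ n) ^ 2 = Y * y"
    by (simp add: sq Y_def)
  have B: "((1 - y) ^ n) ^ 2 = (1 - Y) * (1 - y)"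
    by (simp add: sq Y_def Frobenius_diff)
  have lin: "2 * S * A = Y + y - (1 - S ^ 2)"
    if "A ^ 2 = Y * y" "B ^ 2 = (1 - Y) * (1 - y)" "A + B = S" for A B S
    using that[THEN eq_diff_0] by Groebner_Basis.algebra
  show C: "2 * to_ac s * y ^ n = Y + y - to_ac (1 - s ^ 2)"
    using lin[OF A B s] by simp
  show "(y ^ n) ^ 2 = Y * y" by (fact A)
  show "(Y + y - to_ac (1 - s ^ 2)) ^ 2 = 4 * (1 - to_ac (1 - s ^ 2)) * Y * y"
    unfolding C[symmetric] using A by (simp add: power_mult_distrib)
qed

text \<open>If \<open>y\<close> were fixed by the square of Frobenius, then \<open>A = y\<^sup>n\<close>, \<open>B = (1 - y)\<^sup>n\<close> and \<open>e = A - B\<close>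
  would be fixed by Frobenius. With \<open>s = cos \<alpha>\<close>, \<open>u = sin \<alpha>\<close> and \<open>e = cos \<beta>\<close>, the elements \<open>y\<close>
  and \<open>Y = y\<^sup>q\<close> are then \<open>(1 + cos (\<alpha> \<mp> \<beta>)) / 2\<close>, and \<open>H = sin (\<alpha> - \<beta>)\<close> is a square root of
  \<open>4 y (1 - y)\<close>. Frobenius exchanges \<open>y\<close> and \<open>Y\<close>, so it takes \<open>H\<close> to \<open>sin (\<alpha> + \<beta>)\<close>. The product
  of the two sines is \<open>e\<^sup>2 - s\<^sup>2 = - 4 A B\<close>, whereas it is also \<open>H\<^sup>q\<^sup>+\<^sup>1 = (4 y (1 - y))\<^sup>n = 4 A B\<close>.\<close>
lemma Frobenius_squared_moves_root:
  fixes y :: "'a :: {field, finite} alg_closure"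
  assumes two: "(2 :: 'a) \<noteq> 0" and n: "2 * n = CARD('a) + 1"
    and s: "y ^ n + (1 - y) ^ n = to_ac s" "s \<noteq> 0"
    and u: "u ^ 2 = 1 - s ^ 2" "u \<noteq> 0"
  shows "(y ^ CARD('a)) ^ CARD('a) \<noteq> y"
proof
  assume fixed: "(y ^ CARD('a)) ^ CARD('a) = y"
  define S U where "S = to_ac s" and "U = to_ac u"
  define Y A B where "Y = y ^ CARD('a)" and "A = y ^ n" and "B = (1 - y) ^ n"
  define e where "e = A - B"
  have "to_ac (2 :: 'a) \<noteq> 0"
    using two by (simp del: to_ac_numeral)
  hence two': "(2 :: 'a alg_closure) \<noteq> 0" by simp
  have S: "S \<noteq> 0" "S ^ CARD('a) = S" and U: "U \<noteq> 0" "U ^ CARD('a) = U"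
    using s u by (simp_all add: S_def U_def)
  have US: "U ^ 2 = 1 - S ^ 2"
    unfolding U_def S_def using u by (metis to_ac_1 to_ac_diff to_ac_power)
  have AB: "A + B = S"
    using s by (simp add: A_def B_def S_def)
  have lin: "2 * S * A = Y + y - (1 - S ^ 2)"
    using conjugate_relation(1)[OF n s(1)] by (simp add: A_def Y_def S_def)
  have A2: "A ^ 2 = Y * y"
    using conjugate_relation(2)[OF n s(1)] by (simp add: A_def Y_def)
  have "2 * S * A ^ CARD('a) = 2 * S * A"
  proof -
    have "(2 :: 'a alg_closure) ^ CARD('a) = 2"
      using Frobenius_to_ac[of "2 :: 'a"] by simp
    hence "2 * S * A ^ CARD('a) = (2 * S * A) ^ CARD('a)"
      by (simp add: power_mult_distrib S)
    also have "\<dots> = y + Y - (1 - S ^ 2)"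
    proof -
      have "(S ^ 2) ^ CARD('a) = S ^ 2"
        using S by (metis mult.commute power_mult)
      thus ?thesis
        unfolding lin by (simp add: Frobenius_diff Frobenius_add Y_def fixed)
    qed
    finally show ?thesis using lin by simp
  qed
  hence A: "A ^ CARD('a) = A"
    using two' S by simp
  have "B = S - A"
    using AB by (simp add: eq_diff_eq add.commute)
  hence "B ^ CARD('a) = B"
    by (metis A S(2) Frobenius_diff)
  hence e: "e ^ CARD('a) = e"
    unfolding e_def Frobenius_diff A by simp
  \<comment> \<open>As \<open>y - Y = sin \<alpha> sin \<beta>\<close>, this is \<open>sin \<alpha> cos \<beta> - cos \<alpha> sin \<beta>\<close>.\<close>
  define H where "H = (U ^ 2 * e - (y - Y) * S) / U"
  have HU: "H * U = U ^ 2 * e - (y - Y) * S"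
    using U by (simp add: H_def)
  have "H ^ 2 * U ^ 2 = (4 * (y * (1 - y))) * U ^ 2"
    using HU[THEN eq_diff_0] AB[THEN eq_diff_0] lin[THEN eq_diff_0]
      A2[THEN eq_diff_0] US[THEN eq_diff_0]
    unfolding e_def by Groebner_Basis.algebra
  hence H: "H ^ 2 = 4 * (y * (1 - y))"
    using U by simp
  define H' where "H' = H ^ CARD('a)"
  have HU': "H' * U = U ^ 2 * e + (y - Y) * S"
  proof -
    have U2: "(U ^ 2) ^ CARD('a) = U ^ 2"
      using U by (metis mult.commute power_mult)
    have "H' * U = (H * U) ^ CARD('a)"
      by (simp add: power_mult_distrib U H'_def)
    also have "\<dots> = U ^ 2 * e - (Y - y) * S"
      unfolding HU by (simp add: Frobenius_diff power_mult_distrib U2 S e Y_def fixed)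
    finally show ?thesis by (simp add: algebra_simps)
  qed
  have "(H' * H) * U ^ 2 = (e ^ 2 - S ^ 2) * U ^ 2"
    using HU[THEN eq_diff_0] HU'[THEN eq_diff_0] AB[THEN eq_diff_0] lin[THEN eq_diff_0]
      A2[THEN eq_diff_0] US[THEN eq_diff_0]
    unfolding e_def by Groebner_Basis.algebra
  hence norm: "H ^ CARD('a) * H = e ^ 2 - S ^ 2"
    using U by (simp add: H'_def)
  have "H ^ CARD('a) * H = (H ^ 2) ^ n"
    using n by (metis Suc_eq_plus1 power_Suc2 power_mult)
  also have "\<dots> = 4 ^ n * (A * B)"
    by (simp add: H power_mult_distrib A_def B_def)
  also have "(4 :: 'a alg_closure) ^ n = 4"
  proof -
    have "(4 :: 'a alg_closure) ^ n = 2 ^ (2 * n)"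
      by (simp add: power_mult)
    also have "\<dots> = to_ac (2 :: 'a) ^ CARD('a) * 2"
      unfolding n by (simp add: mult.commute)
    finally show ?thesis by (simp del: to_ac_numeral add: to_ac_numeral[symmetric]) simp
  qed
  finally have "e ^ 2 - S ^ 2 = 4 * (A * B)"
    by (simp add: norm)
  hence "2 * 2 * 2 * (A * B) = 0"
    unfolding AB[symmetric] e_def by (simp add: algebra_simps power2_eq_square)
  hence "A * B = 0"
    using two' by (metis mult_eq_0_iff)
  moreover have "n > 0"
    using n by simp
  ultimately have "y = 0 \<or> y = 1"
    by (auto simp: A_def B_def)
  hence "S = 1"
    using AB \<open>n > 0\<close> by (auto simp: A_def B_def)
  thus False
    using US U by simp
qed

section \<open>Five distinct conjugates\<close>

text \<open>Both \<open>a\<close> and \<open>b\<close> are roots of one monic quadratic over the ring generated by \<open>c\<close> and \<open>x\<close>;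
  this is Vieta's formula for their sum.\<close>
lemma biquadratic_neighbours:
  fixes a x b c :: "'a :: idom"
  assumes "(x + a - c) ^ 2 = 4 * (1 - c) * x * a"
    and "(b + x - c) ^ 2 = 4 * (1 - c) * b * x" and "a \<noteq> b"
  shows "b = 2 * c - (4 * c - 2) * x - a"
proof -
  have "(b - a) * (b - (2 * c - (4 * c - 2) * x - a)) = 0"
    using assms(1,2)[THEN eq_diff_0] by Groebner_Basis.algebra
  thus ?thesis using assms(3) by simp
qed

text \<open>The orbit obeys the recurrence \<open>b = 2 c - (4 c - 2) x - a\<close> for consecutive terms \<open>a, x, b\<close>.
  The roots of its characteristic polynomial \<open>\<lambda>\<^sup>2 + (4 c - 2) \<lambda> + 1\<close> satisfy
  \<open>\<lambda>\<^sup>4 + \<lambda>\<^sup>3 + \<lambda>\<^sup>2 + \<lambda> + 1 = 0\<close> by the equation for \<open>c\<close>, so the fifth power of Frobenius fixes \<open>y\<close>. Because five is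
  prime and \<open>y\<close> itself is moved, its five conjugates are distinct.\<close>
lemma five_conjugates:
  fixes y :: "'a :: {field, finite} alg_closure"
  assumes c: "16 * c ^ 2 - 20 * c + 5 = (0 :: 'a)"
    and rel: "(y ^ CARD('a) + y - to_ac c) ^ 2 = 4 * (1 - to_ac c) * y ^ CARD('a) * y"
    and y: "(y ^ CARD('a)) ^ CARD('a) \<noteq> y"
    and p: "p \<noteq> 0" "ac_eval p y = 0"
  shows "degree p \<ge> 5"
proof -
  define F where "F = (\<lambda>x :: 'a alg_closure. x ^ CARD('a))"
  define K where "K = to_ac c"
  have F_inj: "F a = F b \<longleftrightarrow> a = b" for a b
    by (simp add: F_def)
  have F_root: "ac_eval p (F a) = 0" if "ac_eval p a = 0" for a
    using that by (simp add: F_def ac_eval_Frobenius zero_power)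
  have F_base: "F (2 * K - (4 * K - 2) * b - a) = 2 * K - (4 * K - 2) * F b - F a" for a b
  proof -
    have "F (to_ac (2 * c) - to_ac (4 * c - 2) * b - a)
        = to_ac (2 * c) - to_ac (4 * c - 2) * F b - F a"
      unfolding F_def Frobenius_diff power_mult_distrib Frobenius_to_ac ..
    thus ?thesis by (simp add: K_def)
  qed
  have F_rel: "(F (F a) + F a - K) ^ 2 = 4 * (1 - K) * F (F a) * F a"
    if "(F a + a - K) ^ 2 = 4 * (1 - K) * F a * a" for a
  proof -
    have "F ((F a + a - to_ac c) ^ 2) = F (to_ac (4 * (1 - c)) * F a * a)"
      using that by (simp add: K_def)
    also have "F ((F a + a - to_ac c) ^ 2) = (F (F a + a - to_ac c)) ^ 2"
      unfolding F_def by (simp add: mult.commute flip: power_mult)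
    finally show ?thesis
      unfolding F_def power_mult_distrib Frobenius_diff Frobenius_add Frobenius_to_ac
      by (simp add: K_def)
  qed
  define y1 y2 y3 y4 where "y1 = F y" and "y2 = F y1" and "y3 = F y2" and "y4 = F y3"
  have K: "16 * K ^ 2 - 20 * K + 5 = 0"
  proof -
    have "to_ac (16 * c ^ 2 - 20 * c + 5) = 0"
      using c by (simp only: to_ac_0)
    thus ?thesis by (simp add: K_def)
  qed
  have rel0: "(F y + y - K) ^ 2 = 4 * (1 - K) * F y * y"
    using rel by (simp add: F_def K_def)
  have rec: "y2 = 2 * K - (4 * K - 2) * y1 - y"
    unfolding y2_def y1_def
    using rel0 F_rel[OF rel0] y by (intro biquadratic_neighbours) (auto simp: F_def)
  have rec3: "y3 = 2 * K - (4 * K - 2) * y2 - y1"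
    using arg_cong[OF rec, of F] unfolding F_base by (simp add: y1_def y2_def y3_def)
  have rec4: "y4 = 2 * K - (4 * K - 2) * y3 - y2"
    using arg_cong[OF rec3, of F] unfolding F_base by (simp add: y1_def y2_def y3_def y4_def)
  have rec5: "F y4 = 2 * K - (4 * K - 2) * y4 - y3"
    using arg_cong[OF rec4, of F] unfolding F_base by (simp add: y1_def y2_def y3_def y4_def)
  have period: "F y4 = y"
    using rec[THEN eq_diff_0] rec3[THEN eq_diff_0] rec4[THEN eq_diff_0]
      rec5[THEN eq_diff_0] K[THEN eq_diff_0] by Groebner_Basis.algebra
  have "y2 \<noteq> y"
    using y by (simp add: y1_def y2_def F_def)
  hence "distinct [y, y1, y2, y3, y4]"
    using period unfolding y1_def y2_def y3_def y4_def by (auto simp: F_inj)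
  hence "card (set [y, y1, y2, y3, y4]) = 5"
    by (subst distinct_card) auto
  moreover have "set [y, y1, y2, y3, y4] \<subseteq> {x. ac_eval p x = 0}"
    using p F_root by (auto simp: y1_def y2_def y3_def y4_def)
  moreover have "map_poly to_ac p \<noteq> 0"
    using p(1) by (simp add: map_poly_eq_0_iff)
  ultimately have "5 \<le> card {x. ac_eval p x = 0}"
    by (metis card_mono poly_roots_finite)
  also have "\<dots> \<le> degree (map_poly to_ac p)"
    by (rule card_poly_roots_bound) fact
  finally show ?thesis
    by (simp add: degree_map_poly)
qed

section \<open>The golden parameter\<close>

lemma C_set_iff:
  "c \<in> C_set \<longleftrightarrow> c \<noteq> 0 \<and> 1 - c \<noteq> 0 \<and> (\<exists>u. c = u ^ 2) \<and> (\<exists>v. 1 - c = v ^ 2)"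
  by (auto simp: C_set_def quad_char_def)

text \<open>The two values of \<open>(5 \<plusminus> \<surd>5) / 8\<close>, which are \<open>sin\<^sup>2 (2\<pi>/5)\<close> and \<open>sin\<^sup>2 (\<pi>/5)\<close>, are the roots
  of one quadratic over the prime field.\<close>
lemma golden_quadratic:
  fixes c r :: "'a :: field"
  assumes two: "(2 :: 'a) \<noteq> 0" and r: "r ^ 2 = 5" and c: "8 * c = 5 + r"
  shows "16 * c ^ 2 - 20 * c + 5 = 0"
proof -
  have "2 * 2 * (16 * c ^ 2 - 20 * c + 5) = 0"
    using r[THEN eq_diff_0] c[THEN eq_diff_0] by Groebner_Basis.algebra
  thus ?thesis
    using two by (metis mult_eq_0_iff)
qed

text \<open>The square root of \<open>c\<close> is half the trace of a twentieth root of unity, and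
  \<open>1 - c = ((\<surd>5 - 1) / 4)\<^sup>2\<close>.\<close>
lemma golden_in_C_set:
  fixes c r :: "'a :: {field, finite}"
  assumes q: "[int CARD('a) = 1] (mod 20) \<or> [int CARD('a) = - 1] (mod 20)"
    and r: "r ^ 2 = 5" and c: "8 * c = 5 + r"
  shows "c \<in> C_set"
proof -
  note two = two_nonzero[OF q]
  have four: "(4 :: 'a) \<noteq> 0" and eight: "(8 :: 'a) \<noteq> 0"
    using two power_not_zero[of "2 :: 'a" 2] power_not_zero[of "2 :: 'a" 3] by simp_all
  note c_eq = golden_quadratic[OF two r c]
  obtain t :: 'a where "to_ac t ^ 2 = (5 + to_ac r) / 2"
  proof (rule golden_square_root[OF q])
    have "to_ac (r ^ 2) = to_ac (5 :: 'a)" by (simp only: r)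
    thus "to_ac r ^ 2 = 5" by simp
  qed
  hence "to_ac (t ^ 2) = to_ac ((5 + r) / 2)" by simp
  hence t: "2 * t ^ 2 = 5 + r"
    unfolding to_ac_eq_iff using two by (simp add: field_simps)
  define u where "u = t / 2"
  have ut: "2 * u = t"
    using two by (simp add: u_def)
  have "8 * u ^ 2 = 8 * c"
    using ut[THEN eq_diff_0] t[THEN eq_diff_0] c[THEN eq_diff_0] by Groebner_Basis.algebra
  hence u: "u ^ 2 = c"
    using eight by simp
  define v where "v = (r - 1) / 4"
  have "4 * v = r - 1"
    using four by (simp add: v_def)
  hence "4 * 4 * v ^ 2 = 4 * 4 * (1 - c)"
    using c[THEN eq_diff_0] r[THEN eq_diff_0] by Groebner_Basis.algebra
  hence v: "v ^ 2 = 1 - c"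
    using four by (metis mult_left_cancel mult_eq_0_iff)
  have c0: "c \<noteq> 0"
  proof
    assume "c = 0"
    hence "(5 :: 'a) = 0" using c_eq by simp
    hence "4 * 5 = (0 :: 'a)" by (simp only: mult_zero_right)
    thus False using twenty_nonzero[OF q] by simp
  qed
  have c1: "1 - c \<noteq> 0"
    using c_eq by auto
  show ?thesis
    unfolding C_set_iff using u v c0 c1 by metis
qed

section \<open>The irreducible factors\<close>

theorem corollary4p8:
  assumes "[int CARD('a :: {field, finite}) = 1] (mod 20) \<or> [int CARD('a) = - 1] (mod 20)"
  shows "(\<exists>r :: 'a. r ^ 2 = 5) \<and>
    (\<forall>r c :: 'a. r ^ 2 = 5 \<longrightarrow> c = (5 + r) / 8 \<longrightarrow>
      c \<in> C_set \<and>
      (\<forall>s :: 'a. 1 - s ^ 2 = c \<longrightarrow>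
        (\<forall>p :: 'a poly. lead_coeff p = 1 \<and> irreducible p \<and> p dvd g_poly s \<longrightarrow>
          (\<exists>m. p = [:- m, 25 / 256, - (25 / 32), 35 / 16, - (5 / 2), 1:]))))"
proof (intro conjI allI impI)
  show "\<exists>r :: 'a. r ^ 2 = 5"
    using five_is_square[OF assms] .
next
  fix r c :: 'a
  assume r: "r ^ 2 = 5" and "c = (5 + r) / 8"
  note two = two_nonzero[OF assms]
  have "(8 :: 'a) \<noteq> 0"
    using two power_not_zero[of "2 :: 'a" 3] by simp
  hence c: "8 * c = 5 + r"
    using \<open>c = _\<close> by (simp add: field_simps)
  note c_eq = golden_quadratic[OF two r c]
  show c_mem: "c \<in> C_set"
    using assms r c by (rule golden_in_C_set)

  fix s :: 'a and p :: "'a poly"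
  assume s: "1 - s ^ 2 = c" and p: "lead_coeff p = 1 \<and> irreducible p \<and> p dvd g_poly s"
  obtain u where u: "u ^ 2 = 1 - s ^ 2" "u \<noteq> 0"
    using c_mem s by (auto simp: C_set_iff)
  have s0: "s \<noteq> 0"
    using c_mem s by (auto simp: C_set_iff)
  define n where "n = (CARD('a) + 1) div 2"
  have n: "2 * n = CARD('a) + 1"
    using assms by (rule CARD_mod_20_cases) (simp_all add: n_def)
  obtain y where y: "ac_eval p y = 0"
    using ac_root_exists p by blast
  have "ac_eval (g_poly s) y = 0"
    using p y by (auto elim!: dvdE)
  hence root: "y ^ n + (1 - y) ^ n = to_ac s"
    unfolding g_poly_def Let_def n_def[symmetric] by simp
  have rel: "(y ^ CARD('a) + y - to_ac c) ^ 2 = 4 * (1 - to_ac c) * y ^ CARD('a) * y"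
    using conjugate_relation(3)[OF n root] unfolding s .
  \<comment> \<open>Five distinct conjugates force the degree of \<open>p\<close> up to that of the quintic.\<close>
  have "degree p \<ge> 5"
  proof (rule five_conjugates[OF c_eq rel _ _ y])
    show "(y ^ CARD('a)) ^ CARD('a) \<noteq> y"
      by (rule Frobenius_squared_moves_root[OF two n root s0 u])
    show "p \<noteq> 0" using p by auto
  qed
  define f where "f = (\<lambda>m :: 'a. [:- m, 25 / 256, - (25 / 32), 35 / 16, - (5 / 2), 1:])"
  have f_eval: "ac_eval (f m) y = quintic y - to_ac m" for m
    by (simp add: f_def quintic_def algebra_simps power_numeral_reduce)
  have "quintic y ^ CARD('a) = ac_eval (f 0) y ^ CARD('a)"
    by (simp add: f_eval)
  also have "\<dots> = ac_eval (f 0) (y ^ CARD('a))"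
    by (simp add: ac_eval_Frobenius)
  also have "\<dots> = quintic (y ^ CARD('a))"
    by (simp add: f_def quintic_def algebra_simps power_numeral_reduce)
  also have "\<dots> = quintic y"
  proof (rule quintic_eq_if_biquadratic)
    show "(2 :: 'a alg_closure) \<noteq> 0"
      using two by (metis to_ac_eq_0_iff to_ac_numeral)
    have "to_ac (16 * c ^ 2 - 20 * c + 5) = 0"
      using c_eq by (simp only: to_ac_0)
    thus "16 * to_ac c ^ 2 - 20 * to_ac c + 5 = 0" by simp
  qed (fact rel)
  finally obtain m where m: "quintic y = to_ac m"
    using Frobenius_fixed_imp_in_base by blast
  hence "p dvd f m"
    using p y by (intro irreducible_dvd_if_common_root[of p y]) (simp_all add: f_eval)
  then obtain k where k: "f m = p * k" ..
  have f: "degree (f m) = 5" "lead_coeff (f m) = 1"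
    by (simp_all add: f_def)
  have "k \<noteq> 0"
    using k f by auto
  hence "degree p + degree k = 5"
    using k f p by (subst degree_mult_eq[symmetric]) auto
  hence "degree k = 0"
    using \<open>degree p \<ge> 5\<close> by simp
  then obtain a where a: "k = [:a:]"
    by (rule degree_eq_zeroE)
  have "lead_coeff k = 1"
    using k f p lead_coeff_mult[of p k] by simp
  hence "p = f m"
    using k a by simp
  thus "\<exists>m. p = [:- m, 25 / 256, - (25 / 32), 35 / 16, - (5 / 2), 1:]"
    unfolding f_def by blast
qed

end
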